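(* There exists a universal constant $c>0$ such that the following holds. Let $m,T\ge1$ be integers, let $s\in\{1,\dots,\min(m,T)\}$, and let $N$ be an integer with $N\ge s\max(m,T)\log(2)/8$. Then $$\inf_{\widehat M}\ \sup_{\substack{M^*\in B_\infty\\ \mathrm{rank}(M^* )\le s}}\mathbb E_{M^*}^{\otimes N}\left(\mathcal E_{hinge}(\widehat M)\right)\ge c\,\frac{s\max(m,T)}{N},$$ where the infimum is over all estimators $\widehat M$ (measurable $\mathbb R^{m\times T}$-valued functions of $(X_i,Y_i)_{i=1}^N$).
   Context: $B_\infty=\{M\in\mathbb R^{m\times T}:\max_{p,q}|M_{p,q}|\le1\}$; $(E_{p,q})$ is the canonical basis of $\mathbb R^{m\times T}$; $\langle A,B\rangle=\mathrm{Tr}(A^\top B)$. For $M\in B_\infty$, $\mathbb P_M$ is the distribution of $(X,Y)$ where $X$ is uniformly distributed on $\{E_{p,q}\}$, $Y\in\{-1,1\}$ and $\mathbb P_M(Y=1\mid X=E_{p,q})=(1+M_{p,q})/2$ (i.e. $\mathbb E_M[Y\mid X=E_{p,q}]=M_{p,q}$); $\mathbb E_M^{\otimes N}$ is the expectation with respect to $N$ i.i.d. pairs $(X_i,Y_i)$ distributed according to $\mathbb P_M$. Under $\mathbb P_{M^*}$, the excess hinge risk of a matrix $M$ is $\mathcal E_{hinge}(M)=\mathbb E_{M^*}(1-Y\langle X,M\rangle)_+-\inf_{M'\in\mathbb R^{m\times T}}\mathbb E_{M^*}(1-Y\langle X,M'\rangle)_+$, and $\mathcal E_{hinge}(\widehat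 M)$ is this function evaluated at the random matrix $\widehat M$. *)

theory Defs
  imports
    "HOL-Probability.Probability"
    "Jordan_Normal_Form.DL_Rank"
begin

(* The dimensions m and T are quantified below the universal constant, so matrices are
   carrier-based: an m x T matrix is an element of carrier_mat m T, with 0-based indices. *)

definition basis_mat :: "nat \<Rightarrow> nat \<Rightarrow> nat \<Rightarrow> nat \<Rightarrow> real mat" where
  "basis_mat m T p q = mat m T (\<lambda>(i, j). if i = p \<and> j = q then 1 else 0)"

definition basis_mats :: "nat \<Rightarrow> nat \<Rightarrow> real mat set" where
  "basis_mats m T = {basis_mat m T p q | p q. p < m \<and> q < T}"

definition mat_trace :: "real mat \<Rightarrow> real" where
  "mat_trace A = (\<Sum>i<dim_row A. A $$ (i, i))"

definition frob_inner :: "real mat \<Rightarrow> real mat \<Rightarrow> real" where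
  "frob_inner A B = mat_trace (transpose_mat A * B)"

definition B_inf :: "nat \<Rightarrow> nat \<Rightarrow> real mat set" where
  "B_inf m T = {M \<in> carrier_mat m T. \<forall>p<m. \<forall>q<T. \<bar>M $$ (p, q)\<bar> \<le> 1}"

definition obs_pmf :: "nat \<Rightarrow> nat \<Rightarrow> real mat \<Rightarrow> (real mat \<times> real) pmf" where
  "obs_pmf m T M =
     do {
       (p, q) \<leftarrow> pmf_of_set ({..<m} \<times> {..<T});
       b \<leftarrow> bernoulli_pmf ((1 + M $$ (p, q)) / 2);
       return_pmf (basis_mat m T p q, if b then 1 else - 1)
     }"

definition hinge_risk :: "nat \<Rightarrow> nat \<Rightarrow> real mat \<Rightarrow> real mat \<Rightarrow> real" where
  "hinge_risk m T Mstar M =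
     measure_pmf.expectation (obs_pmf m T Mstar) (\<lambda>(X, Y). max 0 (1 - Y * frob_inner X M))"

definition excess_hinge_risk :: "nat \<Rightarrow> nat \<Rightarrow> real mat \<Rightarrow> real mat \<Rightarrow> real" where
  "excess_hinge_risk m T Mstar M =
     hinge_risk m T Mstar M - (INF M' \<in> carrier_mat m T. hinge_risk m T Mstar M')"

definition samples :: "nat \<Rightarrow> nat \<Rightarrow> nat \<Rightarrow> (real mat \<times> real) list set" where
  "samples m T N = {xs. length xs = N \<and> set xs \<subseteq> basis_mats m T \<times> {-1, 1}}"

(* The sample space is finite and carries the discrete sigma-algebra, so the entrywise
   measurability holds for every function; it is kept because it is part of the notion. *)
definition estimators :: "nat \<Rightarrow> nat \<Rightarrow> nat \<Rightarrow> ((real mat \<times> real) list \<Rightarrow> real mat) set" where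
  "estimators m T N =
     {Mhat \<in> samples m T N \<rightarrow> carrier_mat m T.
        \<forall>p<m. \<forall>q<T. (\<lambda>xs. Mhat xs $$ (p, q)) \<in> borel_measurable (count_space (samples m T N))}"

(* replicate_pmf N is the law of a list of N i.i.d. draws.  Its support is finite here,
   so this Bochner integral is a finite sum for every estimator. *)
definition expected_excess_risk ::
  "nat \<Rightarrow> nat \<Rightarrow> nat \<Rightarrow> real mat \<Rightarrow> ((real mat \<times> real) list \<Rightarrow> real mat) \<Rightarrow> real" where
  "expected_excess_risk m T N Mstar Mhat =
     measure_pmf.expectation (replicate_pmf N (obs_pmf m T Mstar))
       (\<lambda>xs. excess_hinge_risk m T Mstar (Mhat xs))"

end

theory Submission
  imports Defs
begin

text \<open>
  Assouad's method on a hypercube of matrices with entries \<open>d\<close> and \<open>- d\<close>. With \<open>D = s max(m, T)\<close>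
  free signs, each copied along its row (if \<open>T \<le> m\<close>) or column with period \<open>s\<close>, the rank is at
  most \<open>s\<close> and every sign governs at most a fraction \<open>2 / D\<close> of the entries. Flipping one sign
  therefore lowers the Hellinger affinity of \<open>N\<close> observations by at most \<open>2 N d\<^sup>2 / D\<close>, which is
  \<open>1/8\<close> for \<open>d = sqrt (D / N) / 4\<close>. For any prediction \<open>v\<close> the excess hinge losses at true
  entries \<open>d\<close> and \<open>- d\<close> add up to at least \<open>2 d\<close>, so averaging over the hypercube bounds the
  risk below by a multiple of \<open>d\<close>. Since the assumption on \<open>N\<close> bounds \<open>D / N\<close>, this is at
  least a multiple of \<open>D / N\<close>.
\<close>

definition obs_space :: "nat \<Rightarrow> nat \<Rightarrow> (real mat \<times> real) set" where
  "obs_space m T = basis_mats m T \<times> {-1, 1}"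

section \<open>Product laws, Hellinger affinity and the two-point method\<close>

lemma replicate_pmf_Suc_pmf_Cons:
  "pmf (replicate_pmf (Suc n) p) (x # xs) = pmf p x * pmf (replicate_pmf n p) xs"
proof -
  have "replicate_pmf (Suc n) p = map_pmf (\<lambda>(x, xs). x # xs) (pair_pmf p (replicate_pmf n p))"
    by (simp add: pair_pmf_def map_pmf_def bind_assoc_pmf bind_return_pmf)
  moreover have "inj (\<lambda>(x, xs). x # xs)"
    by (auto simp: inj_on_def)
  ultimately show ?thesis
    using pmf_map_inj'[of "\<lambda>(x, xs). x # xs" "pair_pmf p (replicate_pmf n p)" "(x, xs)"]
    by (simp add: pmf_pair)
qed

text \<open>Independence makes the Hellinger affinity multiplicative: each new draw contributes one
  more factor under the square root. This is what lets a bound for one observation control all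
  \<open>n\<close> of them.\<close>

lemma affinity_replicate_pmf:
  assumes "finite S"
  shows "(\<Sum>xs\<in>{xs. set xs \<subseteq> S \<and> length xs = n}.
            sqrt (pmf (replicate_pmf n p) xs * pmf (replicate_pmf n q) xs))
         = (\<Sum>x\<in>S. sqrt (pmf p x * pmf q x)) ^ n"
proof (induction n)
  case 0
  have "{xs. set xs \<subseteq> S \<and> length xs = 0} = {[]}" by auto
  then show ?case by simp
next
  case (Suc n)
  let ?L = "\<lambda>n. {xs. set xs \<subseteq> S \<and> length xs = n}"
  have inj: "inj_on (\<lambda>(xs, x). x # xs) (?L n \<times> S)" by (auto simp: inj_on_def)
  have "(\<Sum>xs\<in>?L (Suc n). sqrt (pmf (replicate_pmf (Suc n) p) xs * pmf (replicate_pmf (Suc n) q) xs))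
      = (\<Sum>(xs, x)\<in>?L n \<times> S.
          sqrt (pmf p x * pmf q x) * sqrt (pmf (replicate_pmf n p) xs * pmf (replicate_pmf n q) xs))"
    unfolding lists_length_Suc_eq
    by (subst sum.reindex[OF inj], rule sum.cong)
       (auto simp: replicate_pmf_Suc_pmf_Cons real_sqrt_mult simp del: replicate_pmf.simps)
  also have "\<dots> = (\<Sum>xs\<in>?L n. \<Sum>x\<in>S.
          sqrt (pmf p x * pmf q x) * sqrt (pmf (replicate_pmf n p) xs * pmf (replicate_pmf n q) xs))"
    by (simp add: sum.cartesian_product)
  also have "\<dots> = (\<Sum>x\<in>S. sqrt (pmf p x * pmf q x)) ^ Suc n"
    by (simp add: Suc.IH[symmetric] sum_product mult.commute, subst sum.swap, simp add: sum_product)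
  finally show ?case .
qed

lemma expectation_pmf_finite:
  fixes f :: "'a \<Rightarrow> real"
  assumes "finite S" "set_pmf p \<subseteq> S"
  shows "measure_pmf.expectation p f = (\<Sum>x\<in>S. f x * pmf p x)"
  using assms by (intro integral_measure_pmf_real) auto

text \<open>Le Cam's two-point argument: no sample makes both losses small, so the two risks add up
  to at least \<open>2 * d\<close> times the overlap of \<open>P\<close> and \<open>Q\<close>, and
  an overlap of 3/8 yields the constant \<open>3 / 4\<close>.\<close>

lemma two_point_bound:
  fixes f g :: "'a \<Rightarrow> real"
  assumes S: "finite S" "set_pmf P \<subseteq> S" "set_pmf Q \<subseteq> S"
    and f: "\<And>x. x \<in> S \<Longrightarrow> 0 \<le> f x" and g: "\<And>x. x \<in> S \<Longrightarrow> 0 \<le> g x"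
    and fg: "\<And>x. x \<in> S \<Longrightarrow> 2 * d \<le> f x + g x" and d: "0 \<le> d"
    and aff: "7 / 8 \<le> (\<Sum>x\<in>S. sqrt (pmf P x * pmf Q x))"
  shows "3 / 4 * d \<le> measure_pmf.expectation P f + measure_pmf.expectation Q g"
proof -
  have one: "(\<Sum>x\<in>S. pmf P x) = 1" "(\<Sum>x\<in>S. pmf Q x) = 1"
    using S by (auto intro: sum_pmf_eq_1)
  have "2 * d * (sqrt (pmf P x * pmf Q x) - (pmf P x + pmf Q x) / 4) \<le> f x * pmf P x + g x * pmf Q x"
    if x: "x \<in> S" for x
  proof -
    let ?a = "min (pmf P x) (pmf Q x)" and ?b = "max (pmf P x) (pmf Q x)"
    \<comment> \<open>AM-GM with the weights 2 and 1/2 gives \<open>sqrt (a b) \<le> a + b / 4\<close>, so that an affinity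
      of 7/8 forces an overlap \<open>\<Sum> min P Q\<close> of at least 3/8.\<close>
    have "sqrt (pmf P x * pmf Q x) = sqrt ((2 * ?a) * (?b / 2))"
      by (auto simp: min_def max_def mult.commute)
    also have "\<dots> \<le> (2 * ?a + ?b / 2) / 2"
      by (intro arith_geo_mean_sqrt) (auto simp: min_def max_def)
    also have "\<dots> \<le> ?a + (pmf P x + pmf Q x) / 4"
      by (auto simp: min_def max_def)
    finally have "2 * d * (sqrt (pmf P x * pmf Q x) - (pmf P x + pmf Q x) / 4) \<le> 2 * d * ?a"
      using d by (intro mult_left_mono) auto
    also have "\<dots> \<le> (f x + g x) * ?a"
      using fg[OF x] by (intro mult_right_mono) (auto simp: min_def)
    also have "\<dots> \<le> f x * pmf P x + g x * pmf Q x"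
      unfolding distrib_right using f[OF x] g[OF x]
      by (intro add_mono mult_left_mono) auto
    finally show ?thesis .
  qed
  then have "(\<Sum>x\<in>S. 2 * d * (sqrt (pmf P x * pmf Q x) - (pmf P x + pmf Q x) / 4))
      \<le> (\<Sum>x\<in>S. f x * pmf P x + g x * pmf Q x)"
    by (rule sum_mono)
  also have "\<dots> = measure_pmf.expectation P f + measure_pmf.expectation Q g"
    using S by (simp add: expectation_pmf_finite sum.distrib)
  also have "(\<Sum>x\<in>S. 2 * d * (sqrt (pmf P x * pmf Q x) - (pmf P x + pmf Q x) / 4))
      = 2 * d * ((\<Sum>x\<in>S. sqrt (pmf P x * pmf Q x)) - 1 / 2)"
    by (simp add: sum_distrib_left[symmetric] sum_subtractf sum_divide_distrib[symmetric] sum.distrib one)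
  finally have "2 * d * ((\<Sum>x\<in>S. sqrt (pmf P x * pmf Q x)) - 1 / 2)
      \<le> measure_pmf.expectation P f + measure_pmf.expectation Q g" .
  moreover have "2 * d * (7 / 8 - 1 / 2) \<le> 2 * d * ((\<Sum>x\<in>S. sqrt (pmf P x * pmf Q x)) - 1 / 2)"
    using d aff by (intro mult_left_mono) auto
  ultimately show ?thesis by simp
qed

section \<open>The law of a single observation\<close>

lemma basis_mat_eq_iff:
  assumes "p < m" "q < T"
  shows "basis_mat m T p q = basis_mat m T p' q' \<longleftrightarrow> p = p' \<and> q = q'"
proof
  assume "basis_mat m T p q = basis_mat m T p' q'"
  then have "basis_mat m T p q $$ (p, q) = basis_mat m T p' q' $$ (p, q)" by simp
  then show "p = p' \<and> q = q'"
    using assms by (simp add: basis_mat_def split: if_splits)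
qed simp

lemma frob_inner_basis_mat:
  assumes "p < m" "q < T" "M \<in> carrier_mat m T"
  shows "frob_inner (basis_mat m T p q) M = M $$ (p, q)"
proof -
  have "frob_inner (basis_mat m T p q) M
      = (\<Sum>i<T. \<Sum>k<m. (if k = p \<and> i = q then M $$ (k, i) else 0))"
    using assms unfolding frob_inner_def mat_trace_def basis_mat_def
    by (auto simp: scalar_prod_def lessThan_atLeast0 intro!: sum.cong)
  also have "\<dots> = (\<Sum>i<T. if i = q then M $$ (p, q) else 0)"
    using assms by (intro sum.cong refl) (auto simp: sum.delta)
  finally show ?thesis using assms by simp
qed

lemma finite_obs_space: "finite (obs_space m T)"
proof -
  have "basis_mats m T = (\<lambda>(p, q). basis_mat m T p q) ` ({..<m} \<times> {..<T})"
    by (auto simp: basis_mats_def)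
  then show ?thesis by (simp add: obs_space_def)
qed

lemma sum_obs_space:
  fixes h :: "real mat \<times> real \<Rightarrow> real"
  shows "(\<Sum>z\<in>obs_space m T. h z) =
    (\<Sum>(p, q)\<in>{..<m} \<times> {..<T}. h (basis_mat m T p q, 1) + h (basis_mat m T p q, -1))"
proof -
  have "basis_mats m T = (\<lambda>(p, q). basis_mat m T p q) ` ({..<m} \<times> {..<T})"
    by (auto simp: basis_mats_def)
  moreover have "inj_on (\<lambda>(p, q). basis_mat m T p q) ({..<m} \<times> {..<T})"
    by (auto simp: inj_on_def basis_mat_eq_iff)
  ultimately have "(\<Sum>X\<in>basis_mats m T. h (X, 1) + h (X, -1)) =
    (\<Sum>(p, q)\<in>{..<m} \<times> {..<T}. h (basis_mat m T p q, 1) + h (basis_mat m T p q, -1))"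
    by (simp add: sum.reindex case_prod_unfold)
  moreover have "(\<Sum>z\<in>obs_space m T. h z) = (\<Sum>X\<in>basis_mats m T. \<Sum>y\<in>{-1, 1}. h (X, y))"
    unfolding obs_space_def by (subst sum.cartesian_product) (simp add: case_prod_eta)
  ultimately show ?thesis by (simp add: add.commute)
qed

lemma set_obs_pmf:
  assumes "1 \<le> m" "1 \<le> T"
  shows "set_pmf (obs_pmf m T M) \<subseteq> obs_space m T"
proof -
  have "(0, 0) \<in> {..<m} \<times> {..<T}" using assms by auto
  then have I: "{..<m} \<times> {..<T} \<noteq> {}" by blast
  show ?thesis
  proof
    fix z assume "z \<in> set_pmf (obs_pmf m T M)"
    then obtain p q b where "p < m" "q < T" "z = (basis_mat m T p q, if b then 1 else - 1)"
      unfolding obs_pmf_def set_bind_pmf set_pmf_of_set[OF I finite_cartesian_product[OF finite_lessThan finite_lessThan]]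
      by (auto simp: set_bind_pmf)
    then show "z \<in> obs_space m T" by (auto simp: obs_space_def basis_mats_def)
  qed
qed

lemma set_replicate_obs_pmf:
  assumes "1 \<le> m" "1 \<le> T"
  shows "set_pmf (replicate_pmf N (obs_pmf m T M)) \<subseteq> samples m T N"
  using set_obs_pmf[OF assms, of M]
  by (auto simp: set_replicate_pmf samples_def obs_space_def)

lemma finite_samples: "finite (samples m T N)"
  using finite_lists_length_eq[OF finite_obs_space[of m T], of N]
  by (simp add: samples_def obs_space_def conj_commute)

text \<open>Distinct positions give distinct basis matrices, so only the draw of
  \<open>(p, q)\<close> itself contributes mass. Membership in \<open>B_inf\<close> puts the
  parameter of \<open>bernoulli_pmf\<close> into [0, 1], where it is not truncated.\<close>

lemma pmf_obs_pmf:
  assumes M: "M \<in> B_inf m T" and pq: "p < m" "q < T" and y: "y = 1 \<or> y = - 1"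
  shows "pmf (obs_pmf m T M) (basis_mat m T p q, y) = (1 + y * M $$ (p, q)) / 2 / (real m * real T)"
proof -
  let ?I = "{..<m} \<times> {..<T}"
  define K where "K = (\<lambda>(p, q). map_pmf (\<lambda>b. (basis_mat m T p q, if b then 1 else - 1 :: real))
     (bernoulli_pmf ((1 + M $$ (p, q)) / 2)))"
  have I: "?I \<noteq> {}" "finite ?I" using pq by auto
  have K: "pmf (K (p', q')) (basis_mat m T p q, y)
      = (if (p', q') = (p, q) then (1 + y * M $$ (p, q)) / 2 else 0)" for p' q'
  proof (cases "(p', q') = (p, q)")
    case True
    let ?k = "\<lambda>b. (basis_mat m T p q, if b then 1 else - 1 :: real)"
    have "\<bar>M $$ (p, q)\<bar> \<le> 1" using M pq by (auto simp: B_inf_def)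
    then have r: "0 \<le> (1 + M $$ (p, q)) / 2" "(1 + M $$ (p, q)) / 2 \<le> 1" by auto
    have "inj ?k" by (auto simp: inj_on_def)
    then have *: "pmf (K (p, q)) (?k b) = pmf (bernoulli_pmf ((1 + M $$ (p, q)) / 2)) b" for b
      unfolding K_def prod.case by (rule pmf_map_inj')
    show ?thesis
      using True y *[of True] *[of False] r by (auto simp: field_simps)
  next
    case False
    then have "(basis_mat m T p q, y) \<notin> set_pmf (K (p', q'))"
      using basis_mat_eq_iff[OF pq, of p' q'] by (auto simp: K_def)
    then show ?thesis using False by (auto simp: set_pmf_iff)
  qed
  have "obs_pmf m T M = pmf_of_set ?I \<bind> K"
    unfolding obs_pmf_def K_def by (simp add: map_pmf_def case_prod_unfold)
  then have "pmf (obs_pmf m T M) (basis_mat m T p q, y)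
      = (\<Sum>z\<in>?I. pmf (K z) (basis_mat m T p q, y)) / real (card ?I)"
    using pmf_bind_pmf_of_set[OF I] by simp
  also have "(\<Sum>z\<in>?I. pmf (K z) (basis_mat m T p q, y))
     = (\<Sum>z\<in>?I. if z = (p, q) then (1 + y * M $$ (p, q)) / 2 else 0)"
    by (intro sum.cong refl) (auto simp: K split: if_splits)
  also have "\<dots> = (1 + y * M $$ (p, q)) / 2" using pq by (subst sum.delta) auto
  finally show ?thesis by simp
qed

section \<open>Excess hinge risk, entry by entry\<close>

lemma hinge_risk_eq_sum:
  assumes mT: "1 \<le> m" "1 \<le> T" and Mstar: "Mstar \<in> B_inf m T" and M: "M \<in> carrier_mat m T"
  shows "hinge_risk m T Mstar M = (\<Sum>z\<in>{..<m} \<times> {..<T}.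
    ((1 + Mstar $$ z) * max 0 (1 - M $$ z) + (1 - Mstar $$ z) * max 0 (1 + M $$ z)) / 2 / (real m * real T))"
  unfolding hinge_risk_def expectation_pmf_finite[OF finite_obs_space set_obs_pmf[OF mT]] sum_obs_space
  using Mstar M by (intro sum.cong refl)
    (auto simp: pmf_obs_pmf frob_inner_basis_mat add_divide_distrib[symmetric] mult.commute)

text \<open>The contribution of an entry to the excess hinge risk (before dividing by \<open>m T\<close>) when the
  true entry is \<open>d * e\<close> with \<open>e\<close> a sign; the infimum \<open>1 - d\<close> is attained by predicting \<open>e\<close>.\<close>

definition hinge_excess :: "real \<Rightarrow> real \<Rightarrow> real \<Rightarrow> real" where
  "hinge_excess d e v = ((1 + d * e) * max 0 (1 - v) + (1 - d * e) * max 0 (1 + v)) / 2 - (1 - d)"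

lemma hinge_excess_nonneg:
  assumes "0 \<le> d" "d \<le> 1" "e = 1 \<or> e = - 1"
  shows "0 \<le> hinge_excess d e v"
proof -
  \<comment> \<open>Beyond -1 or 1 one hinge term vanishes, while the other exceeds 2 and has weight
    at least \<open>1 - d\<close>. In between both terms are affine and the excess is
    \<open>d - e * (d * v)\<close>.\<close>
  consider "v < - 1" | "- 1 \<le> v" "v \<le> 1" | "1 < v" by linarith
  then show ?thesis
  proof cases
    case 1
    have "(1 - d) * 2 \<le> (1 + d * e) * (1 - v)"
      using assms 1 by (intro mult_mono) auto
    then show ?thesis using 1 by (simp add: hinge_excess_def)
  next
    case 2
    have "d * v \<le> d * 1" "d * (- 1) \<le> d * v" using assms 2 by (intro mult_left_mono; simp)+
    moreover have "hinge_excess d e v = d - e * (d * v)"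
      using 2 by (simp add: hinge_excess_def field_simps)
    ultimately show ?thesis using assms(3) by auto
  next
    case 3
    have "(1 - d) * 2 \<le> (1 - d * e) * (1 + v)"
      using assms 3 by (intro mult_mono) auto
    then show ?thesis using 3 by (simp add: hinge_excess_def)
  qed
qed

text \<open>In the sum the weights \<open>1 + d * e\<close> and \<open>1 - d * e\<close> average
  out, leaving the hinge losses of \<open>v\<close> for the labels 1 and -1; these add up to at
  least 2 whatever \<open>v\<close> is.\<close>

lemma hinge_excess_opposite:
  "2 * d \<le> hinge_excess d e v + hinge_excess d (- e) v"
proof -
  have "hinge_excess d e v + hinge_excess d (- e) v = max 0 (1 - v) + max 0 (1 + v) - 2 + 2 * d"
    by (simp add: hinge_excess_def field_simps)
  then show ?thesis by simp
qed

text \<open>The infimum in the excess risk is at most the risk of the sign matrix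
  \<open>mat m T e\<close>, so subtracting the latter instead gives a lower bound, which splits into
  entries.\<close>

lemma excess_hinge_risk_ge:
  assumes mT: "1 \<le> m" "1 \<le> T" and d: "0 \<le> d" "d \<le> 1"
    and e: "\<And>z. e z = 1 \<or> e z = - 1"
    and M: "M \<in> carrier_mat m T"
  shows "(\<Sum>z\<in>{..<m} \<times> {..<T}. hinge_excess d (e z) (M $$ z)) / (real m * real T)
    \<le> excess_hinge_risk m T (mat m T (\<lambda>z. d * e z)) M"
proof -
  let ?M = "mat m T (\<lambda>z. d * e z)" and ?I = "{..<m} \<times> {..<T}"
  have abs_e: "\<bar>e z\<bar> = 1" for z using e[of z] by auto
  have in_B: "?M \<in> B_inf m T" using d by (auto simp: B_inf_def abs_mult abs_e)
  \<comment> \<open>Hinge losses are nonnegative; boundedness from below is what makes the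
    real-valued \<open>INF\<close> a lower bound of the risks.\<close>
  have "bdd_below (hinge_risk m T ?M ` carrier_mat m T)"
    unfolding bdd_below_def hinge_risk_def
    by (intro exI[of _ 0]) (auto intro!: Bochner_Integration.integral_nonneg)
  then have inf_le: "(INF M' \<in> carrier_mat m T. hinge_risk m T ?M M') \<le> hinge_risk m T ?M (mat m T e)"
    by (intro cINF_lower) auto
  have "(1 + d * e z) * max 0 (1 - e z) + (1 - d * e z) * max 0 (1 + e z) = 2 * (1 - d)" for z
    using e[of z] by auto
  then have sign_risk: "hinge_risk m T ?M (mat m T e) = (\<Sum>z\<in>?I. (1 - d) / (real m * real T))"
    by (subst hinge_risk_eq_sum[OF mT in_B]) (auto intro!: sum.cong simp: diff_divide_distrib simp del: sum_constant)
  have "hinge_risk m T ?M M - hinge_risk m T ?M (mat m T e)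
      = (\<Sum>z\<in>?I. hinge_excess d (e z) (M $$ z)) / (real m * real T)"
    unfolding sign_risk hinge_risk_eq_sum[OF mT in_B M] sum_divide_distrib sum_subtractf[symmetric]
    by (intro sum.cong refl) (auto simp: hinge_excess_def diff_divide_distrib)
  then show ?thesis using inf_le by (simp add: excess_hinge_risk_def)
qed

section \<open>The hypercube and the affinity of neighbouring corners\<close>

definition set_sign :: "'a set \<Rightarrow> 'a \<Rightarrow> real" where
  "set_sign A j = (if j \<in> A then 1 else - 1)"

text \<open>Corners of the hypercube are encoded as subsets of the index set: moving to a neighbour
  is then an involution of \<open>Pow J\<close>, and averaging over corners is a sum over
  \<open>Pow J\<close>.\<close>

definition toggle :: "'a \<Rightarrow> 'a set \<Rightarrow> 'a set" where
  "toggle j A = (if j \<in> A then A - {j} else insert j A)"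

lemma set_sign_cases: "set_sign A j = 1 \<or> set_sign A j = - 1"
  by (simp add: set_sign_def)

lemma set_sign_toggle:
  "set_sign (toggle j A) i = (if i = j then - set_sign A i else set_sign A i)"
  by (cases "j \<in> A"; cases "i = j") (simp_all add: set_sign_def toggle_def)

lemma bij_betw_toggle:
  assumes "j \<in> J"
  shows "bij_betw (toggle j) (Pow J) (Pow J)"
proof (rule bij_betwI[where g = "toggle j"])
  have "toggle j A \<subseteq> J" if "A \<subseteq> J" for A
    using that assms unfolding toggle_def by (cases "j \<in> A") auto
  then show "toggle j \<in> Pow J \<rightarrow> Pow J" "toggle j \<in> Pow J \<rightarrow> Pow J"
    by (simp_all add: Pi_iff)
  show "toggle j (toggle j A) = A" for A
    by (cases "j \<in> A") (simp_all add: toggle_def insert_absorb)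
  then show "toggle j (toggle j A) = A" for A .
qed

text \<open>The map \<open>f\<close> sends a position to the coordinate whose sign it carries, so a
  fibre of \<open>f\<close> is a block of entries that flip together.\<close>

definition cube_mat :: "nat \<Rightarrow> nat \<Rightarrow> real \<Rightarrow> (nat \<times> nat \<Rightarrow> 'a) \<Rightarrow> 'a set \<Rightarrow> real mat" where
  "cube_mat m T d f A = mat m T (\<lambda>z. d * set_sign A (f z))"

lemma cube_mat_in_B_inf:
  assumes "0 \<le> d" "d \<le> 1"
  shows "cube_mat m T d f A \<in> B_inf m T"
  using assms by (auto simp: B_inf_def cube_mat_def set_sign_def)

text \<open>Entries outside the fibre of \<open>j\<close> keep their law and contribute their full
  mass. Each entry of the fibre contributes \<open>sqrt (1 - d\<^sup>2)\<close> times its mass,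
  which is at least \<open>1 - d\<^sup>2\<close> times it, and the fibre has total mass at most
  \<open>k\<close>.\<close>

lemma affinity_toggle:
  assumes mT: "1 \<le> m" "1 \<le> T" and d: "0 \<le> d" "d \<le> 1"
    and fib: "real (card {z \<in> {..<m} \<times> {..<T}. f z = j}) \<le> k * (real m * real T)"
  shows "1 - k * d\<^sup>2 \<le> (\<Sum>z\<in>obs_space m T.
    sqrt (pmf (obs_pmf m T (cube_mat m T d f A)) z * pmf (obs_pmf m T (cube_mat m T d f (toggle j A))) z))"
    (is "_ \<le> ?aff")
proof -
  let ?I = "{..<m} \<times> {..<T}" and ?n = "real m * real T"
  let ?P = "obs_pmf m T (cube_mat m T d f A)" and ?Q = "obs_pmf m T (cube_mat m T d f (toggle j A))"
  have n: "0 < ?n" using mT by simp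
  have d2: "d\<^sup>2 \<le> 1" using d by (simp add: power_le_one)
  have entry: "(1 - (if f (p, q) = j then d\<^sup>2 else 0)) / ?n \<le>
      sqrt (pmf ?P (basis_mat m T p q, 1) * pmf ?Q (basis_mat m T p q, 1)) +
      sqrt (pmf ?P (basis_mat m T p q, - 1) * pmf ?Q (basis_mat m T p q, - 1))"
    if pq: "p < m" "q < T" for p q
  proof -
    let ?e = "set_sign A (f (p, q))"
    have P: "pmf ?P (basis_mat m T p q, y) = (1 + y * (d * ?e)) / 2 / ?n"
      if "y = 1 \<or> y = - 1" for y
      using pmf_obs_pmf[OF cube_mat_in_B_inf[OF d] pq that, of f A] pq by (simp add: cube_mat_def)
    have Q: "pmf ?Q (basis_mat m T p q, y)
        = (1 + y * (d * (if f (p, q) = j then - ?e else ?e))) / 2 / ?n"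
      if "y = 1 \<or> y = - 1" for y
      using pmf_obs_pmf[OF cube_mat_in_B_inf[OF d] pq that, of f "toggle j A"] pq
      by (simp add: cube_mat_def set_sign_toggle)
    have e: "?e = 1 \<or> ?e = - 1" by (rule set_sign_cases)
    show ?thesis
    proof (cases "f (p, q) = j")
      case False
      then have "pmf ?Q (basis_mat m T p q, y) = pmf ?P (basis_mat m T p q, y)"
        if "y = 1 \<or> y = - 1" for y
        unfolding P[OF that] Q[OF that] by simp
      then have "sqrt (pmf ?P (basis_mat m T p q, y) * pmf ?Q (basis_mat m T p q, y))
          = (1 + y * (d * ?e)) / 2 / ?n" if "y = 1 \<or> y = - 1" for y
        using that by (simp only: P[OF that, symmetric] real_sqrt_abs2 abs_of_nonneg[OF pmf_nonneg])
      then show ?thesis using False by (simp add: add_divide_distrib[symmetric])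
    next
      case True
      \<comment> \<open>For either label the two masses are \<open>(1 + d) / (2 * ?n)\<close> and
        \<open>(1 - d) / (2 * ?n)\<close> in some order.\<close>
      have "pmf ?P (basis_mat m T p q, y) * pmf ?Q (basis_mat m T p q, y)
          = (1 - d\<^sup>2) / (2 * ?n)\<^sup>2" if "y = 1 \<or> y = - 1" for y
        unfolding P[OF that] Q[OF that] using that e True n
        by (auto simp: field_simps power2_eq_square)
      then have *: "sqrt (pmf ?P (basis_mat m T p q, y) * pmf ?Q (basis_mat m T p q, y))
          = sqrt (1 - d\<^sup>2) / (2 * ?n)" if "y = 1 \<or> y = - 1" for y
        using that n by (simp add: real_sqrt_divide real_sqrt_mult)
      have "(1 - d\<^sup>2)\<^sup>2 \<le> 1 - d\<^sup>2"
        using d2 power_decreasing[of 1 2 "1 - d\<^sup>2"] by simp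
      then have "1 - d\<^sup>2 \<le> sqrt (1 - d\<^sup>2)" by (rule real_le_rsqrt)
      then have "(1 - d\<^sup>2) / ?n \<le> sqrt (1 - d\<^sup>2) / ?n" using n by (intro divide_right_mono) auto
      then show ?thesis using True * by (simp add: mult.commute)
    qed
  qed
  have "k * d\<^sup>2 \<ge> real (card {z \<in> ?I. f z = j}) * d\<^sup>2 / ?n"
    using mult_right_mono[OF fib, of "d\<^sup>2"] n by (simp add: field_simps)
  then have "1 - k * d\<^sup>2 \<le> (?n - real (card {z \<in> ?I. f z = j}) * d\<^sup>2) / ?n"
    using mT by (simp add: diff_divide_distrib)
  also have "\<dots> = (\<Sum>z\<in>?I. (1 - (if f z = j then d\<^sup>2 else 0)) / ?n)"
    by (simp add: sum_divide_distrib[symmetric] sum_subtractf sum.If_cases Int_def)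
  also have "\<dots> \<le> ?aff"
    unfolding sum_obs_space
  proof (rule sum_mono)
    fix z assume "z \<in> ?I"
    then show "(1 - (if f z = j then d\<^sup>2 else 0)) / ?n \<le> (case z of (p, q) \<Rightarrow>
        sqrt (pmf ?P (basis_mat m T p q, 1) * pmf ?Q (basis_mat m T p q, 1)) +
        sqrt (pmf ?P (basis_mat m T p q, - 1) * pmf ?Q (basis_mat m T p q, - 1)))"
      using entry[of "fst z" "snd z"] by (cases z) (simp only: prod.case fst_conv snd_conv mem_Sigma_iff lessThan_iff)
  qed
  finally show ?thesis .
qed

lemma affinity_toggle_replicate:
  assumes mT: "1 \<le> m" "1 \<le> T" and d: "0 \<le> d" "d \<le> 1"
    and fib: "real (card {z \<in> {..<m} \<times> {..<T}. f z = j}) \<le> k * (real m * real T)"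
    and small: "real N * (k * d\<^sup>2) \<le> 1 / 8"
  shows "7 / 8 \<le> (\<Sum>xs\<in>samples m T N.
    sqrt (pmf (replicate_pmf N (obs_pmf m T (cube_mat m T d f A))) xs
        * pmf (replicate_pmf N (obs_pmf m T (cube_mat m T d f (toggle j A)))) xs))"
proof (cases "N = 0")
  case True
  have "samples m T 0 = {[]}" by (auto simp: samples_def)
  then show ?thesis using True by simp
next
  case False
  \<comment> \<open>Since \<open>N\<close> is at least 1 here, \<open>small\<close> bounds
    \<open>k * d\<^sup>2\<close> by 1/8, as Bernoulli's inequality and the monotonicity of powers
    require. For \<open>N = 0\<close> it says nothing about \<open>k * d\<^sup>2\<close>, hence the
    separate case.\<close>
  have "k * d\<^sup>2 \<le> real N * (k * d\<^sup>2) \<or> k * d\<^sup>2 < 0"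
    using False mult_right_mono[of 1 "real N" "k * d\<^sup>2"] by (cases "k * d\<^sup>2 < 0") auto
  then have kd: "- (k * d\<^sup>2) \<ge> - 1" "1 - k * d\<^sup>2 \<ge> 0" using small by linarith+
  have "7 / 8 \<le> 1 + real N * (- (k * d\<^sup>2))" using small by simp
  also have "\<dots> \<le> (1 - k * d\<^sup>2) ^ N"
    using Bernoulli_inequality[OF kd(1), of N] by simp
  also have "\<dots> \<le> (\<Sum>z\<in>obs_space m T.
    sqrt (pmf (obs_pmf m T (cube_mat m T d f A)) z * pmf (obs_pmf m T (cube_mat m T d f (toggle j A))) z)) ^ N"
    by (intro power_mono affinity_toggle[OF mT d fib] kd(2))
  also have "\<dots> = (\<Sum>xs\<in>samples m T N.
    sqrt (pmf (replicate_pmf N (obs_pmf m T (cube_mat m T d f A))) xs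
        * pmf (replicate_pmf N (obs_pmf m T (cube_mat m T d f (toggle j A)))) xs))"
    unfolding affinity_replicate_pmf[OF finite_obs_space, symmetric]
    by (simp add: samples_def obs_space_def conj_commute)
  finally show ?thesis .
qed

section \<open>Averaging over the hypercube\<close>

lemma hypercube_lower_bound:
  fixes f :: "nat \<times> nat \<Rightarrow> 'a"
  assumes mT: "1 \<le> m" "1 \<le> T" and d: "0 \<le> d" "d \<le> 1" and J: "finite J"
    and f: "\<And>z. z \<in> {..<m} \<times> {..<T} \<Longrightarrow> f z \<in> J"
    and fib: "\<And>j. j \<in> J \<Longrightarrow> real (card {z \<in> {..<m} \<times> {..<T}. f z = j}) \<le> k * (real m * real T)"
    and small: "real N * (k * d\<^sup>2) \<le> 1 / 8"
    and Mhat: "Mhat \<in> estimators m T N"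
  shows "\<exists>A. 3 / 8 * d \<le> expected_excess_risk m T N (cube_mat m T d f A) Mhat"
proof (rule ccontr)
  let ?I = "{..<m} \<times> {..<T}" and ?n = "real m * real T"
  define P where "P = (\<lambda>A. replicate_pmf N (obs_pmf m T (cube_mat m T d f A)))"
  define h where "h = (\<lambda>z A xs. hinge_excess d (set_sign A (f z)) (Mhat xs $$ z))"
  define R where "R = (\<lambda>z A. measure_pmf.expectation (P A) (h z A))"
  assume "\<not> ?thesis"
  then have less: "expected_excess_risk m T N (cube_mat m T d f A) Mhat < 3 / 8 * d" for A
    by (simp add: not_le)
  have n: "0 < ?n" using mT by simp
  have P: "set_pmf (P A) \<subseteq> samples m T N" for A
    unfolding P_def by (rule set_replicate_obs_pmf[OF mT])
  have carrier: "Mhat xs \<in> carrier_mat m T" if "xs \<in> samples m T N" for xs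
    using Mhat that by (auto simp: estimators_def)
  have risk: "(\<Sum>z\<in>?I. R z A) / ?n \<le> expected_excess_risk m T N (cube_mat m T d f A) Mhat" for A
  proof -
    have "(\<Sum>z\<in>?I. R z A) / ?n = (\<Sum>xs\<in>samples m T N. (\<Sum>z\<in>?I. h z A xs) / ?n * pmf (P A) xs)"
      unfolding R_def expectation_pmf_finite[OF finite_samples P]
      by (subst sum.swap) (simp add: sum_divide_distrib sum_distrib_right)
    also have "\<dots> \<le> (\<Sum>xs\<in>samples m T N.
        excess_hinge_risk m T (cube_mat m T d f A) (Mhat xs) * pmf (P A) xs)"
      unfolding h_def cube_mat_def
      by (intro sum_mono mult_right_mono excess_hinge_risk_ge mT d carrier set_sign_cases pmf_nonneg)
    also have "\<dots> = expected_excess_risk m T N (cube_mat m T d f A) Mhat"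
      unfolding expectation_pmf_finite[OF finite_samples P, symmetric]
      by (simp add: expected_excess_risk_def P_def)
    finally show ?thesis .
  qed
  \<comment> \<open>Each entry is tested along its own coordinate \<open>f z\<close>: the two
    corners carry opposite signs at \<open>z\<close>, while their sample laws remain close.\<close>
  have flip: "3 / 4 * d \<le> R z A + R z (toggle (f z) A)" if z: "z \<in> ?I" for z A
    unfolding R_def
  proof (rule two_point_bound[OF finite_samples P P _ _ _ d(1)])
    show "7 / 8 \<le> (\<Sum>xs\<in>samples m T N. sqrt (pmf (P A) xs * pmf (P (toggle (f z) A)) xs))"
      unfolding P_def by (rule affinity_toggle_replicate[OF mT d fib[OF f[OF z]] small])
    show "2 * d \<le> h z A xs + h z (toggle (f z) A) xs" for xs
      using hinge_excess_opposite by (simp add: h_def set_sign_toggle)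
  qed (simp_all add: h_def hinge_excess_nonneg d set_sign_cases)
  \<comment> \<open>As \<open>toggle (f z)\<close> permutes \<open>Pow J\<close>, summing the bound
    for pairs counts every corner twice.\<close>
  have avg: "real (card (Pow J)) * (3 / 8 * d) \<le> (\<Sum>A\<in>Pow J. R z A)" if z: "z \<in> ?I" for z
  proof -
    have "real (card (Pow J)) * (3 / 4 * d) \<le> (\<Sum>A\<in>Pow J. R z A + R z (toggle (f z) A))"
      using flip[OF z] by (intro sum_bounded_below)
    also have "\<dots> = 2 * (\<Sum>A\<in>Pow J. R z A)"
      using sum.reindex_bij_betw[OF bij_betw_toggle[OF f[OF z]], of "R z"] by (simp add: sum.distrib)
    finally show ?thesis by simp
  qed
  \<comment> \<open>If every corner had risk below \<open>3 / 8 * d\<close>, so would their average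
    over the finite nonempty set \<open>Pow J\<close>, against the bounds for the entries.\<close>
  have "real (card (Pow J)) * (3 / 8 * d) = (\<Sum>z\<in>?I. real (card (Pow J)) * (3 / 8 * d)) / ?n"
    using mT by simp
  also have "\<dots> \<le> (\<Sum>z\<in>?I. \<Sum>A\<in>Pow J. R z A) / ?n"
    using n avg by (intro divide_right_mono sum_mono) auto
  also have "\<dots> = (\<Sum>A\<in>Pow J. (\<Sum>z\<in>?I. R z A) / ?n)"
    by (subst sum.swap) (simp add: sum_divide_distrib)
  also have "\<dots> \<le> (\<Sum>A\<in>Pow J. expected_excess_risk m T N (cube_mat m T d f A) Mhat)"
    by (intro sum_mono risk)
  also have "\<dots> < (\<Sum>A\<in>Pow J. 3 / 8 * d)"
    using J less by (intro sum_strict_mono) auto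
  finally show False by simp
qed

section \<open>Sign patterns of low rank\<close>

text \<open>The matrix is a sum of \<open>s\<close> outer products, each of rank at most 1; the
  induction removes one at a time by subadditivity of the rank.\<close>

lemma rank_le_sum_products:
  assumes "M \<in> carrier_mat m T"
    and "\<And>p q. p < m \<Longrightarrow> q < T \<Longrightarrow> M $$ (p, q) = (\<Sum>j<s. g j p * h j q)"
  shows "vec_space.rank m (M :: 'a :: field mat) \<le> s"
  using assms
proof (induction s arbitrary: M)
  case 0
  then have "M = 0\<^sub>m m T" by (intro eq_matI) auto
  then show ?case by (simp add: vec_space.rank_0I)
next
  case (Suc s)
  let ?A = "mat m T (\<lambda>(p, q). \<Sum>j<s. g j p * h j q)" and ?B = "mat m T (\<lambda>(p, q). g s p * h s q)"
  have "M = ?A + ?B" using Suc.prems by (intro eq_matI) auto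
  then have "vec_space.rank m M \<le> vec_space.rank m ?A + vec_space.rank m ?B"
    using vec_space.rank_subadditive[of ?A m T ?B] by simp
  also have "\<dots> \<le> s + 1"
    by (intro add_mono Suc.IH vec_space.rank_le_1_product_entries[where f = "g s" and g = "h s"]) auto
  finally show ?case by simp
qed

text \<open>A residue class has at most \<open>n div s + 1\<close> members below \<open>n\<close>;
  the additional one costs \<open>s \<le> n\<close> after scaling, hence the factor 2.\<close>

lemma card_mod_eq_le:
  assumes "1 \<le> s" "s \<le> n"
  shows "real s * real (card {i. i < n \<and> i mod s = b}) \<le> 2 * real n"
proof -
  have "{i. i < n \<and> i mod s = b} \<subseteq> (\<lambda>u. u * s + b) ` {..n div s}"
  proof
    fix i assume i: "i \<in> {i. i < n \<and> i mod s = b}"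
    then have "i = (i div s) * s + b" "i div s \<le> n div s" by (auto intro: div_le_mono)
    then show "i \<in> (\<lambda>u. u * s + b) ` {..n div s}" by blast
  qed
  then have "card {i. i < n \<and> i mod s = b} \<le> card {..n div s}"
    using surj_card_le[of "{..n div s}"] by blast
  then have "s * card {i. i < n \<and> i mod s = b} \<le> s * (n div s + 1)" by (intro mult_le_mono2) simp
  also have "\<dots> \<le> n + s" by (simp add: distrib_left)
  also have "\<dots> \<le> 2 * n" using assms by simp
  finally show ?thesis
    by (metis of_nat_le_iff of_nat_mult of_nat_numeral)
qed

text \<open>The longer dimension indexes the signs in full and the shorter one only modulo
  \<open>s\<close>. A fibre is thus one residue class within a single row or column, and the matrix
  is a sum over residues of a sign vector times the indicator of a class.\<close>

lemma exists_low_rank_cube: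
  assumes s: "s \<in> {1..min m T}"
  obtains J :: "(nat \<times> nat) set" and f where "finite J"
    "\<And>z. z \<in> {..<m} \<times> {..<T} \<Longrightarrow> f z \<in> J"
    "\<And>j. j \<in> J \<Longrightarrow> real (card {z \<in> {..<m} \<times> {..<T}. f z = j})
        \<le> 2 / (real s * real (max m T)) * (real m * real T)"
    "\<And>d A. vec_space.rank m (cube_mat m T d f A) \<le> s"
proof -
  \<comment> \<open>Here \<open>k\<close> stands for \<open>s\<close>, \<open>a\<close> for the
    longer and \<open>b\<close> for the shorter dimension; the size of a residue class becomes a
    fraction of all entries.\<close>
  have scaled_le: "c \<le> 2 / (k * a) * (a * b)" if "0 < k" "0 < a" "k * c \<le> 2 * b" for a b c k :: real
    using that by (simp add: field_simps)
  show thesis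
  proof (cases "T \<le> m")
    case True
    let ?f = "\<lambda>(p, q). (p, q mod s)"
    show ?thesis
    proof (rule that[of "{..<m} \<times> {..<s}" ?f])
      fix j :: "nat \<times> nat" assume "j \<in> {..<m} \<times> {..<s}"
      then obtain a b where j: "j = (a, b)" "a < m" by auto
      have "{z \<in> {..<m} \<times> {..<T}. ?f z = j} = {a} \<times> {q. q < T \<and> q mod s = b}"
        using j by auto
      then have "real s * real (card {z \<in> {..<m} \<times> {..<T}. ?f z = j}) \<le> 2 * real T"
        using card_mod_eq_le[of s T b] s by (simp add: card_cartesian_product)
      then show "real (card {z \<in> {..<m} \<times> {..<T}. ?f z = j})
          \<le> 2 / (real s * real (max m T)) * (real m * real T)"
        using s True scaled_le[of "real s" "real m"] by (simp add: max_absorb1)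
    next
      fix d A
      show "vec_space.rank m (cube_mat m T d ?f A) \<le> s"
      proof (rule rank_le_sum_products[where T = T
            and g = "\<lambda>j p. d * set_sign A (p, j)" and h = "\<lambda>j q. if q mod s = j then 1 else 0"])
        fix p q assume "p < m" "q < T"
        moreover have "q mod s < s" using s by simp
        ultimately show "cube_mat m T d ?f A $$ (p, q)
          = (\<Sum>j<s. d * set_sign A (p, j) * (if q mod s = j then 1 else 0))"
          by (simp add: cube_mat_def mult_delta_left mult_delta_right)
      qed (simp add: cube_mat_def)
    qed (use s in auto)
  next
    case False
    let ?f = "\<lambda>(p, q). (q, p mod s)"
    show ?thesis
    proof (rule that[of "{..<T} \<times> {..<s}" ?f])
      fix j :: "nat \<times> nat" assume "j \<in> {..<T} \<times> {..<s}"
      then obtain a b where j: "j = (a, b)" "a < T" by auto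
      have "{z \<in> {..<m} \<times> {..<T}. ?f z = j} = {p. p < m \<and> p mod s = b} \<times> {a}"
        using j by auto
      then have "real s * real (card {z \<in> {..<m} \<times> {..<T}. ?f z = j}) \<le> 2 * real m"
        using card_mod_eq_le[of s m b] s by (simp add: card_cartesian_product)
      then show "real (card {z \<in> {..<m} \<times> {..<T}. ?f z = j})
          \<le> 2 / (real s * real (max m T)) * (real m * real T)"
        using s False scaled_le[of "real s" "real T"] by (simp add: max_absorb2 mult.commute[of "real m"])
    next
      fix d A
      show "vec_space.rank m (cube_mat m T d ?f A) \<le> s"
      proof (rule rank_le_sum_products[where T = T
            and g = "\<lambda>j p. if p mod s = j then 1 else 0" and h = "\<lambda>j q. d * set_sign A (q, j)"])
        fix p q assume "p < m" "q < T"
        moreover have "p mod s < s" using s by simp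
        ultimately show "cube_mat m T d ?f A $$ (p, q)
          = (\<Sum>j<s. (if p mod s = j then 1 else 0) * (d * set_sign A (q, j)))"
          by (simp add: cube_mat_def mult_delta_left mult_delta_right)
      qed (simp add: cube_mat_def)
    qed (use s in auto)
  qed
qed

section \<open>Choice of the entry size and of the constant\<close>

theorem theorem4p5:
  shows "\<exists>c::real. c > 0 \<and>
    (\<forall>(m::nat) (T::nat) (s::nat) (N::nat).
       m \<ge> 1 \<longrightarrow> T \<ge> 1 \<longrightarrow> s \<in> {1..min m T} \<longrightarrow>
       real N \<ge> real s * real (max m T) * ln 2 / 8 \<longrightarrow>
       (INF Mhat \<in> estimators m T N.
          SUP Mstar \<in> {M \<in> B_inf m T. vec_space.rank m M \<le> s}.
            ereal (expected_excess_risk m T N Mstar Mhat))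
         \<ge> ereal (c * (real s * real (max m T) / real N)))"
proof (intro exI[of _ "3 / 128"] conjI allI impI INF_greatest)
  fix m T s N :: nat and Mhat
  assume mT: "1 \<le> m" "1 \<le> T" and s: "s \<in> {1..min m T}"
    and N: "real s * real (max m T) * ln 2 / 8 \<le> real N"
    and Mhat: "Mhat \<in> estimators m T N"
  define D where "D = real s * real (max m T)"
  define x where "x = D / real N"
  \<comment> \<open>This size makes \<open>real N * (2 / D * d\<^sup>2)\<close> exactly 1/8, the
    loss of affinity that the two-point bound tolerates.\<close>
  define d where "d = sqrt x / 4"
  have D: "0 < D" using s mT by (auto simp: D_def)
  \<comment> \<open>With \<open>ln 2\<close> at least 1/2 the assumption on \<open>N\<close> gives
    \<open>x \<le> 16\<close>, which is just what \<open>d \<le> 1\<close> requires.\<close>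
  have "D * (1 / 2) \<le> D * ln 2" using D ln2_ge_two_thirds by (intro mult_left_mono) auto
  then have DN: "D \<le> 16 * real N" using N by (simp add: D_def)
  then have N0: "0 < real N" using D by linarith
  have x: "0 \<le> x" "x \<le> 16" using D DN N0 by (auto simp: x_def field_simps)
  have sqrt_x: "sqrt x \<le> 4" using real_sqrt_le_mono[OF x(2)] by simp
  have d: "0 \<le> d" "d \<le> 1" using x sqrt_x by (auto simp: d_def)
  have "d\<^sup>2 = x / 16" using x by (simp add: d_def power_divide)
  then have small: "real N * (2 / D * d\<^sup>2) \<le> 1 / 8" using D N0 by (simp add: x_def)
  \<comment> \<open>For \<open>x \<le> 16\<close> one has \<open>x / 4 \<le> sqrt x\<close>, so
    \<open>d\<close> is at least \<open>x / 16\<close>; the constant is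
    \<open>3 / 128 = 3 / 8 * (1 / 16)\<close>.\<close>
  have "x = sqrt x * sqrt x" using x by simp
  also have "\<dots> \<le> 4 * sqrt x" using sqrt_x x by (intro mult_right_mono) auto
  finally have "3 / 128 * x \<le> 3 / 8 * d" by (simp add: d_def)
  obtain J :: "(nat \<times> nat) set" and f where J: "finite J"
    "\<And>z. z \<in> {..<m} \<times> {..<T} \<Longrightarrow> f z \<in> J"
    "\<And>j. j \<in> J \<Longrightarrow> real (card {z \<in> {..<m} \<times> {..<T}. f z = j}) \<le> 2 / D * (real m * real T)"
    and rank: "\<And>d A. vec_space.rank m (cube_mat m T d f A) \<le> s"
    using exists_low_rank_cube[OF s] unfolding D_def by blast
  obtain A where "3 / 8 * d \<le> expected_excess_risk m T N (cube_mat m T d f A) Mhat"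
    using hypercube_lower_bound[OF mT d J small Mhat] by blast
  then have "ereal (3 / 128 * x) \<le> ereal (expected_excess_risk m T N (cube_mat m T d f A) Mhat)"
    using \<open>3 / 128 * x \<le> 3 / 8 * d\<close> by simp
  also have "\<dots> \<le> (SUP Mstar \<in> {M \<in> B_inf m T. vec_space.rank m M \<le> s}.
            ereal (expected_excess_risk m T N Mstar Mhat))"
    using cube_mat_in_B_inf[OF d] rank by (intro SUP_upper) auto
  finally show "ereal (3 / 128 * (real s * real (max m T) / real N))
      \<le> (SUP Mstar \<in> {M \<in> B_inf m T. vec_space.rank m M \<le> s}.
            ereal (expected_excess_risk m T N Mstar Mhat))"
    by (simp add: x_def D_def)
qed simp

end
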